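(* Let the dictionaries $\Phi=(\varphi_1,\dots,\varphi_s)$ and $\Phi\cup\{\psi\}=(\varphi_1,\dots,\varphi_s,\psi)$ both satisfy the moment assumption of the context. Write $$F(\Phi\cup\{\psi\})=\begin{pmatrix}A&b\\ b^{\top}&d\end{pmatrix},\qquad Y(\Phi\cup\{\psi\})=\begin{pmatrix}y\\ \eta\end{pmatrix},$$ where $A=F(\Phi)$, $y=Y(\Phi)$, $b=\mathrm{Cov}_0(\varphi,\psi)+\mathrm{Cov}_1(\varphi,\psi)$ with $\varphi=(\varphi_1,\dots,\varphi_s)^{\top}$, $d=\mathrm{Var}_0\psi+\mathrm{Var}_1\psi$ and $\eta=\mathbb E_1\psi-\mathbb E_0\psi$. Put $\tilde Y=\eta-b^{\top}A^{-1}y$ and $S=d-b^{\top}A^{-1}b$. Then $S>0$ and $$J(\Phi\cup\{\psi\})-J(\Phi)=\frac{\tilde Y^{2}}{S}\ \ge\ 0,$$ with equality if and only if $\tilde Y=0$.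
   Context: $f_0$ and $f_1$ are probability densities on $\mathbb R$; $\mathbb E_j,\mathrm{Var}_j,\mathrm{Cov}_j$ ($j=0,1$) refer to one observation $x$ with density $f_j$. A dictionary $\Phi$ is a finite list of real functions of $x$, also written as a column vector $\varphi$. For a dictionary $\Phi$ with vector $\varphi$: $F(\Phi)=\mathrm{Cov}_0\varphi+\mathrm{Cov}_1\varphi$, $Y(\Phi)=\mathbb E_1\varphi-\mathbb E_0\varphi$, $J(\Phi)=Y(\Phi)^{\top}F(\Phi)^{-1}Y(\Phi)$. Moment assumption on a dictionary: every feature has a finite second moment under $f_0$ and under $f_1$; the covariance matrix $\mathrm{Cov}_0\varphi$ is positive definite; $f_1$ vanishes wherever $f_0$ does. *)

theory Defs
  imports
    "HOL-Probability.Probability"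
    "Jordan_Normal_Form.Gauss_Jordan_Elimination"
begin

no_notation inner (infix \<open>\<bullet>\<close> 70)

definition prob_density_fun :: "(real \<Rightarrow> real) \<Rightarrow> bool" where
  "prob_density_fun f \<longleftrightarrow>
     f \<in> borel_measurable borel \<and> (\<forall>x. 0 \<le> f x) \<and> has_bochner_integral lborel f 1"

text \<open>All moments below are taken with respect to the law of a single observation with density \<open>f\<close>.\<close>

definition law :: "(real \<Rightarrow> real) \<Rightarrow> real measure" where
  "law f = density lborel (\<lambda>x. ennreal (f x))"

definition expect :: "(real \<Rightarrow> real) \<Rightarrow> (real \<Rightarrow> real) \<Rightarrow> real" where
  "expect f g = (\<integral>x. g x \<partial>law f)"

definition Var :: "(real \<Rightarrow> real) \<Rightarrow> (real \<Rightarrow> real) \<Rightarrow> real" where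
  "Var f g = expect f (\<lambda>x. (g x - expect f g)\<^sup>2)"

definition Cov :: "(real \<Rightarrow> real) \<Rightarrow> (real \<Rightarrow> real) \<Rightarrow> (real \<Rightarrow> real) \<Rightarrow> real" where
  "Cov f g h = expect f (\<lambda>x. (g x - expect f g) * (h x - expect f h))"

type_synonym dictionary = "(real \<Rightarrow> real) list"

definition Cov_mat :: "(real \<Rightarrow> real) \<Rightarrow> dictionary \<Rightarrow> real mat" where
  "Cov_mat f \<Phi> = mat (length \<Phi>) (length \<Phi>) (\<lambda>(i, j). Cov f (\<Phi> ! i) (\<Phi> ! j))"

definition Cov_vec :: "(real \<Rightarrow> real) \<Rightarrow> dictionary \<Rightarrow> (real \<Rightarrow> real) \<Rightarrow> real vec" where
  "Cov_vec f \<Phi> \<psi> = vec (length \<Phi>) (\<lambda>i. Cov f (\<Phi> ! i) \<psi>)"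

definition expect_vec :: "(real \<Rightarrow> real) \<Rightarrow> dictionary \<Rightarrow> real vec" where
  "expect_vec f \<Phi> = vec (length \<Phi>) (\<lambda>i. expect f (\<Phi> ! i))"

text \<open>Meaningful for invertible matrices only; unspecified otherwise.\<close>

definition inv_mat :: "real mat \<Rightarrow> real mat" where
  "inv_mat A = the (mat_inverse A)"

definition pos_def_mat :: "real mat \<Rightarrow> bool" where
  "pos_def_mat A \<longleftrightarrow> square_mat A \<and> transpose_mat A = A \<and>
     (\<forall>v \<in> carrier_vec (dim_row A). v \<noteq> 0\<^sub>v (dim_row A) \<longrightarrow> 0 < v \<bullet> (A *\<^sub>v v))"

definition F_mat :: "(real \<Rightarrow> real) \<Rightarrow> (real \<Rightarrow> real) \<Rightarrow> dictionary \<Rightarrow> real mat" where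
  "F_mat f\<^sub>0 f\<^sub>1 \<Phi> = Cov_mat f\<^sub>0 \<Phi> + Cov_mat f\<^sub>1 \<Phi>"

definition Y_vec :: "(real \<Rightarrow> real) \<Rightarrow> (real \<Rightarrow> real) \<Rightarrow> dictionary \<Rightarrow> real vec" where
  "Y_vec f\<^sub>0 f\<^sub>1 \<Phi> = expect_vec f\<^sub>1 \<Phi> - expect_vec f\<^sub>0 \<Phi>"

definition J_val :: "(real \<Rightarrow> real) \<Rightarrow> (real \<Rightarrow> real) \<Rightarrow> dictionary \<Rightarrow> real" where
  "J_val f\<^sub>0 f\<^sub>1 \<Phi> = Y_vec f\<^sub>0 f\<^sub>1 \<Phi> \<bullet> (inv_mat (F_mat f\<^sub>0 f\<^sub>1 \<Phi>) *\<^sub>v Y_vec f\<^sub>0 f\<^sub>1 \<Phi>)"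

text \<open>Measurability of a feature is required separately: it does not follow from
  integrability of its square.\<close>

definition finite_second_moment :: "(real \<Rightarrow> real) \<Rightarrow> (real \<Rightarrow> real) \<Rightarrow> bool" where
  "finite_second_moment f g \<longleftrightarrow>
     g \<in> borel_measurable (law f) \<and> integrable (law f) (\<lambda>x. (g x)\<^sup>2)"

definition moment_assumption ::
    "(real \<Rightarrow> real) \<Rightarrow> (real \<Rightarrow> real) \<Rightarrow> dictionary \<Rightarrow> bool" where
  "moment_assumption f\<^sub>0 f\<^sub>1 \<Phi> \<longleftrightarrow>
     (\<forall>g \<in> set \<Phi>. finite_second_moment f\<^sub>0 g \<and> finite_second_moment f\<^sub>1 g) \<and>
     pos_def_mat (Cov_mat f\<^sub>0 \<Phi>) \<and>
     (\<forall>x. f\<^sub>0 x = 0 \<longrightarrow> f\<^sub>1 x = 0)"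

end

theory Submission
  imports Defs "Jordan_Normal_Form.Determinant"
begin

text \<open>
  Positive definiteness of \<open>F\<close> is inherited from \<open>Cov\<^sub>0\<close>, since \<open>Cov\<^sub>1\<close> is positive semidefinite.
  With \<open>u = A\<^sup>-\<^sup>1 b\<close> and \<open>w = A\<^sup>-\<^sup>1 y\<close>, evaluating the quadratic form of the extended matrix at
  \<open>(u, -1)\<close> gives the Schur complement \<open>S\<close>, whence \<open>S > 0\<close>; and the extended linear system
  with right-hand side \<open>(y, \<eta>)\<close> is solved by \<open>(w - t u, t)\<close> for \<open>t = Yt / S\<close>, which yields the
  increment of \<open>J\<close> without computing a block inverse.
\<close>

section \<open>Positive definite matrices and linear systems\<close>

lemma inv_mat_inverse:
  assumes A: "A \<in> carrier_mat n n" and "pos_def_mat A"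
  shows "inv_mat A \<in> carrier_mat n n" "A * inv_mat A = 1\<^sub>m n" "inv_mat A * A = 1\<^sub>m n"
proof -
  \<comment> \<open>A singular matrix has a nonzero kernel vector, on which the quadratic form would
    vanish.\<close>
  have "det A \<noteq> 0"
  proof
    assume "det A = 0"
    then obtain v where v: "v \<in> carrier_vec n" "v \<noteq> 0\<^sub>v n" "A *\<^sub>v v = 0\<^sub>v n"
      using det_0_iff_vec_prod_zero[OF A] by blast
    then have "0 < v \<bullet> (A *\<^sub>v v)"
      using assms by (auto simp: pos_def_mat_def)
    then show False using v by simp
  qed
  then have "A \<in> Units (ring_mat TYPE(real) n ())"
    by (rule det_non_zero_imp_unit[OF A])
  \<comment> \<open>Being a unit rules out the outcome \<open>None\<close>, so \<open>the\<close> in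
    \<open>inv_mat\<close> extracts a genuine two-sided inverse.\<close>
  then obtain B where "mat_inverse A = Some B"
    using mat_inverse(1)[OF A, where b = "()"] by (cases "mat_inverse A") auto
  then show "inv_mat A \<in> carrier_mat n n" "A * inv_mat A = 1\<^sub>m n" "inv_mat A * A = 1\<^sub>m n"
    using mat_inverse(2)[OF A] by (auto simp: inv_mat_def)
qed

text \<open>Reduces evaluating an inverse at a vector to exhibiting one solution of the linear
  system.\<close>

lemma inv_mat_mult_vec_eqI:
  assumes "A \<in> carrier_mat n n" "pos_def_mat A" "z \<in> carrier_vec n" "A *\<^sub>v z = v"
  shows "inv_mat A *\<^sub>v v = z"
  using inv_mat_inverse[OF assms(1,2)] assms
  by (metis assoc_mult_mat_vec one_mult_mat_vec)

lemma mult_inv_mat_vec: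
  assumes "A \<in> carrier_mat n n" "pos_def_mat A" "v \<in> carrier_vec n"
  shows "inv_mat A *\<^sub>v v \<in> carrier_vec n" "A *\<^sub>v (inv_mat A *\<^sub>v v) = v"
  using inv_mat_inverse[OF assms(1,2)] assms
  by (auto simp flip: assoc_mult_mat_vec)

lemma pos_def_mat_add_semidef:
  fixes A B :: "real mat"
  assumes A: "A \<in> carrier_mat n n" and B: "B \<in> carrier_mat n n"
    and "pos_def_mat A" "transpose_mat B = B"
    and "\<And>v. v \<in> carrier_vec n \<Longrightarrow> 0 \<le> v \<bullet> (B *\<^sub>v v)"
  shows "pos_def_mat (A + B)"
  unfolding pos_def_mat_def
proof (intro conjI ballI impI)
  show "square_mat (A + B)" using A B by auto
  show "transpose_mat (A + B) = A + B"
    using assms by (auto simp: pos_def_mat_def transpose_add)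
  fix v :: "real vec" assume v: "v \<in> carrier_vec (dim_row (A + B))" "v \<noteq> 0\<^sub>v (dim_row (A + B))"
  then have vn: "v \<in> carrier_vec n" using B by simp
  have "v \<bullet> ((A + B) *\<^sub>v v) = v \<bullet> (A *\<^sub>v v) + v \<bullet> (B *\<^sub>v v)"
    using A B vn
    by (subst add_mult_distrib_mat_vec[OF A B vn],
        intro scalar_prod_add_distrib[of _ n]) auto
  moreover have "0 < v \<bullet> (A *\<^sub>v v)"
    using v A B assms(3) by (auto simp: pos_def_mat_def)
  ultimately show "0 < v \<bullet> ((A + B) *\<^sub>v v)"
    using assms(5)[OF vn] by linarith
qed

text \<open>The only block computation required: it is applied once to the test vector that produces
  the Schur complement and once to the solution of the extended system. Scalars appear as blocks of
  size 1.\<close>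

lemma bordered_mat_mult_vec:
  fixes A :: "real mat"
  assumes A: "A \<in> carrier_mat n n" and b: "b \<in> carrier_vec n" and x: "x \<in> carrier_vec n"
  shows "four_block_mat A (mat_of_cols n [b]) (mat_of_rows n [b]) (mat 1 1 (\<lambda>_. d)) *\<^sub>v
           (x @\<^sub>v vec 1 (\<lambda>_. t)) = (A *\<^sub>v x + t \<cdot>\<^sub>v b) @\<^sub>v vec 1 (\<lambda>_. b \<bullet> x + d * t)"
proof -
  have "mat_of_cols n [b] *\<^sub>v vec 1 (\<lambda>_. t) = t \<cdot>\<^sub>v b"
    using b by (intro eq_vecI) (auto simp: scalar_prod_def mat_of_cols_def)
  moreover have "mat_of_rows n [b] *\<^sub>v x + mat 1 1 (\<lambda>_. d) *\<^sub>v vec 1 (\<lambda>_. t) =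
      vec 1 (\<lambda>_. b \<bullet> x + d * t)"
    using b x by (intro eq_vecI) (auto simp: scalar_prod_def mat_of_rows_def)
  ultimately show ?thesis
    by (subst four_block_mat_mult_vec[of _ n n _ 1 _ 1]) (use A b x in auto)
qed

lemma schur_complement_pos_def:
  fixes A :: "real mat"
  assumes A: "A \<in> carrier_mat n n" and b: "b \<in> carrier_vec n" and y: "y \<in> carrier_vec n"
    and Apd: "pos_def_mat A"
    and M: "M = four_block_mat A (mat_of_cols n [b]) (mat_of_rows n [b]) (mat 1 1 (\<lambda>_. d))"
    and Mpd: "pos_def_mat M"
    and S: "S = d - b \<bullet> (inv_mat A *\<^sub>v b)"
    and r: "r = \<eta> - b \<bullet> (inv_mat A *\<^sub>v y)"
  shows "0 < S"
    and "(y @\<^sub>v vec 1 (\<lambda>_. \<eta>)) \<bullet> (inv_mat M *\<^sub>v (y @\<^sub>v vec 1 (\<lambda>_. \<eta>))) =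
           y \<bullet> (inv_mat A *\<^sub>v y) + r\<^sup>2 / S"
proof -
  define u where "u = inv_mat A *\<^sub>v b"
  define w where "w = inv_mat A *\<^sub>v y"
  note u = mult_inv_mat_vec[OF A Apd b, folded u_def]
  note w = mult_inv_mat_vec[OF A Apd y, folded w_def]
  have Mc: "M \<in> carrier_mat (n + 1) (n + 1)"
    unfolding M by (rule four_block_carrier_mat) (use A in auto)
  have neg1: "A *\<^sub>v u + (-1) \<cdot>\<^sub>v b = 0\<^sub>v n" using u b by (intro eq_vecI) auto
  \<comment> \<open>The upper block vanishes because \<open>A\<close> maps \<open>u\<close> to
    \<open>b\<close>; the lower entry is \<open>b \<bullet> u - d\<close>.\<close>
  have "M *\<^sub>v (u @\<^sub>v vec 1 (\<lambda>_. -1)) = 0\<^sub>v n @\<^sub>v vec 1 (\<lambda>_. - S)"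
    unfolding M bordered_mat_mult_vec[OF A b u(1)] neg1 by (simp add: S u_def)
  then have "(u @\<^sub>v vec 1 (\<lambda>_. -1)) \<bullet> (M *\<^sub>v (u @\<^sub>v vec 1 (\<lambda>_. -1))) = S"
    using u by (simp add: scalar_prod_append[of _ n _ 1]) (simp add: scalar_prod_def)
  \<comment> \<open>The last coordinate, at index \<open>n\<close> counting from 0, is -1.\<close>
  moreover have "u @\<^sub>v vec 1 (\<lambda>_. -1) \<noteq> 0\<^sub>v (n + 1)"
  proof
    assume "u @\<^sub>v vec 1 (\<lambda>_. -1) = 0\<^sub>v (n + 1)"
    then have "(u @\<^sub>v vec 1 (\<lambda>_. -1)) $ n = (0\<^sub>v (n + 1) :: real vec) $ n" by simp
    then show False using u by simp
  qed
  moreover have "u @\<^sub>v vec 1 (\<lambda>_. -1) \<in> carrier_vec (n + 1)"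
    using u by (intro append_carrier_vec) auto
  ultimately show "0 < S"
    using Mpd Mc unfolding pos_def_mat_def by (metis carrier_matD(1))
  \<comment> \<open>Block elimination dictates both witnesses: the upper rows force
    \<open>x = w - t u\<close>, and substitution into the last row leaves
    \<open>t * S = r\<close>.\<close>
  define t where "t = r / S"
  have tS: "t * S = r" using \<open>0 < S\<close> by (simp add: t_def)
  define x where "x = w - t \<cdot>\<^sub>v u"
  have x: "x \<in> carrier_vec n" using u w by (simp add: x_def)
  have "A *\<^sub>v x = y - t \<cdot>\<^sub>v b"
    unfolding x_def using u w A by (simp add: mult_minus_distrib_mat_vec[OF A] mult_mat_vec[OF A])
  then have top: "A *\<^sub>v x + t \<cdot>\<^sub>v b = y" using y b by (intro eq_vecI) auto
  have "b \<bullet> x = b \<bullet> w - t * (b \<bullet> u)"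
    unfolding x_def using b u w by (subst scalar_prod_minus_distrib[of _ n]) auto
  then have bot: "b \<bullet> x + d * t = \<eta>"
    using tS by (simp add: S r u_def[symmetric] w_def[symmetric] algebra_simps)
  have "M *\<^sub>v (x @\<^sub>v vec 1 (\<lambda>_. t)) = y @\<^sub>v vec 1 (\<lambda>_. \<eta>)"
    unfolding M bordered_mat_mult_vec[OF A b x] top bot ..
  then have "inv_mat M *\<^sub>v (y @\<^sub>v vec 1 (\<lambda>_. \<eta>)) = x @\<^sub>v vec 1 (\<lambda>_. t)"
    by (intro inv_mat_mult_vec_eqI[OF Mc Mpd] append_carrier_vec x) simp
  then have "(y @\<^sub>v vec 1 (\<lambda>_. \<eta>)) \<bullet> (inv_mat M *\<^sub>v (y @\<^sub>v vec 1 (\<lambda>_. \<eta>))) = y \<bullet> x + \<eta> * t"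
    using x y by (simp add: scalar_prod_append[of _ n _ 1]) (simp add: scalar_prod_def)
  also have "y \<bullet> x = y \<bullet> w - t * (y \<bullet> u)"
    unfolding x_def using y u w by (subst scalar_prod_minus_distrib[of _ n]) auto
  \<comment> \<open>Symmetry of \<open>A\<close> moves it across the product. The terms in
    \<open>t\<close> then combine to \<open>t * (\<eta> - b \<bullet> w)\<close>, which is
    \<open>t * r\<close>.\<close>
  also have "y \<bullet> u = b \<bullet> w"
  proof -
    have "y \<bullet> u = (transpose_mat A *\<^sub>v w) \<bullet> u"
      using Apd w by (simp add: pos_def_mat_def)
    also have "\<dots> = w \<bullet> b"
      using transpose_vec_mult_scalar[OF A u(1) w(1)] u by simp
    finally show ?thesis using comm_scalar_prod[OF b w(1)] by simp
  qed
  finally have "(y @\<^sub>v vec 1 (\<lambda>_. \<eta>)) \<bullet> (inv_mat M *\<^sub>v (y @\<^sub>v vec 1 (\<lambda>_. \<eta>))) = y \<bullet> w + t * r"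
    by (simp add: r w_def algebra_simps)
  then show "(y @\<^sub>v vec 1 (\<lambda>_. \<eta>)) \<bullet> (inv_mat M *\<^sub>v (y @\<^sub>v vec 1 (\<lambda>_. \<eta>))) =
      y \<bullet> (inv_mat A *\<^sub>v y) + r\<^sup>2 / S"
    by (simp add: t_def w_def power2_eq_square)
qed

section \<open>Second moments and covariance matrices\<close>

lemma prob_space_law:
  assumes "prob_density_fun f"
  shows "prob_space (law f)"
proof
  have f: "f \<in> borel_measurable borel" "integrable lborel f" "integral\<^sup>L lborel f = 1" "\<And>x. 0 \<le> f x"
    using assms by (auto simp: prob_density_fun_def has_bochner_integral_iff)
  then have "emeasure (law f) (space (law f)) = (\<integral>\<^sup>+x. ennreal (f x) \<partial>lborel)"
    by (simp add: law_def emeasure_density)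
  also have "\<dots> = 1"
    using f by (subst nn_integral_eq_integral) auto
  finally show "emeasure (law f) (space (law f)) = 1" .
qed

lemma integrable_mult_square_integrable:
  fixes g h :: "'a \<Rightarrow> real"
  assumes [measurable]: "g \<in> borel_measurable M" "h \<in> borel_measurable M"
    and "integrable M (\<lambda>x. (g x)\<^sup>2)" "integrable M (\<lambda>x. (h x)\<^sup>2)"
  shows "integrable M (\<lambda>x. g x * h x)"
proof (rule Bochner_Integration.integrable_bound)
  show "integrable M (\<lambda>x. (g x)\<^sup>2 + (h x)\<^sup>2)"
    using assms by simp
  \<comment> \<open>From \<open>2 * \<bar>g x\<bar> * \<bar>h x\<bar> \<le> (g x)\<^sup>2 + (h
    x)\<^sup>2\<close>; the factor 2 may be dropped since the product is nonnegative.\<close>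
  have "\<bar>g x * h x\<bar> \<le> (g x)\<^sup>2 + (h x)\<^sup>2" for x
    using sum_squares_bound[of "\<bar>g x\<bar>" "\<bar>h x\<bar>"] abs_ge_zero[of "g x * h x"]
    unfolding abs_mult power2_abs by linarith
  then show "AE x in M. norm (g x * h x) \<le> norm ((g x)\<^sup>2 + (h x)\<^sup>2)"
    by simp
qed measurable

text \<open>On a probability space square integrability implies integrability, and constants are
  integrable, so every term of the expanded product is integrable.\<close>

lemma integrable_centered_mult:
  assumes "prob_density_fun f" "finite_second_moment f g" "finite_second_moment f h"
  shows "integrable (law f) (\<lambda>x. (g x - c) * (h x - c'))"
proof -
  interpret prob_space "law f" by (rule prob_space_law) fact
  have gh: "g \<in> borel_measurable (law f)" "h \<in> borel_measurable (law f)"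
    "integrable (law f) (\<lambda>x. (g x)\<^sup>2)" "integrable (law f) (\<lambda>x. (h x)\<^sup>2)"
    using assms by (auto simp: finite_second_moment_def)
  then have "integrable (law f) g" "integrable (law f) h" "integrable (law f) (\<lambda>x. g x * h x)"
    by (auto intro: square_integrable_imp_integrable integrable_mult_square_integrable)
  then have "integrable (law f) (\<lambda>x. g x * h x - c * h x - c' * g x + c * c')"
    by simp
  then show ?thesis by (simp add: algebra_simps)
qed

text \<open>The quadratic form at \<open>v\<close> is the variance of the linear combination of the
  features with coefficients \<open>v\<close>, hence the integral of a square.\<close>

lemma Cov_mat_semidef:
  assumes "prob_density_fun f" "\<And>g. g \<in> set \<Phi> \<Longrightarrow> finite_second_moment f g"
    and v: "v \<in> carrier_vec (length \<Phi>)"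
  shows "0 \<le> v \<bullet> (Cov_mat f \<Phi> *\<^sub>v v)"
proof -
  let ?n = "length \<Phi>"
  define c where "c i x = (\<Phi> ! i) x - expect f (\<Phi> ! i)" for i x
  \<comment> \<open>Exchanging sums and integrals needs integrability of the summands:
    \<open>int\<close> serves the inner sum, \<open>int'\<close> the outer one.\<close>
  have int: "integrable (law f) (\<lambda>x. c i x * c j x)" if "i < ?n" "j < ?n" for i j
    unfolding c_def using that assms by (intro integrable_centered_mult) auto
  have int': "integrable (law f) (\<lambda>x. v $ i * (\<Sum>j<?n. c i x * c j x * v $ j))" if "i < ?n" for i
    using that by (intro integrable_mult_right Bochner_Integration.integrable_sum integrable_mult_left int) auto
  have "v \<bullet> (Cov_mat f \<Phi> *\<^sub>v v) =
      (\<Sum>i<?n. v $ i * (\<Sum>j<?n. (\<integral>x. c i x * c j x \<partial>law f) * v $ j))"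
    using v by (simp add: scalar_prod_def Cov_mat_def Cov_def c_def expect_def lessThan_atLeast0)
  also have "\<dots> = (\<integral>x. (\<Sum>i<?n. v $ i * (\<Sum>j<?n. c i x * c j x * v $ j)) \<partial>law f)"
    using int int' by (simp add: Bochner_Integration.integral_sum)
  \<comment> \<open>The double sum factors pointwise as the square of a single sum.\<close>
  also have "\<dots> = (\<integral>x. (\<Sum>i<?n. v $ i * c i x)\<^sup>2 \<partial>law f)"
    by (simp add: power2_eq_square sum_product sum_distrib_left mult_ac)
  also have "\<dots> \<ge> 0"
    by simp
  finally show ?thesis .
qed

section \<open>Adjoining a feature to the dictionary\<close>

lemma Cov_commute: "Cov f g h = Cov f h g"
  by (simp add: Cov_def mult.commute)

lemma Var_eq_Cov: "Var f g = Cov f g g"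
  by (simp add: Var_def Cov_def power2_eq_square)

lemma Cov_mat_carrier [simp]: "Cov_mat f \<Phi> \<in> carrier_mat (length \<Phi>) (length \<Phi>)"
  by (simp add: Cov_mat_def)

lemma F_mat_carrier [simp]: "F_mat f\<^sub>0 f\<^sub>1 \<Phi> \<in> carrier_mat (length \<Phi>) (length \<Phi>)"
  by (simp add: F_mat_def)

lemma Y_vec_carrier [simp]: "Y_vec f\<^sub>0 f\<^sub>1 \<Phi> \<in> carrier_vec (length \<Phi>)"
  by (simp add: Y_vec_def expect_vec_def)

lemma F_mat_pos_def:
  assumes "prob_density_fun f\<^sub>1" "moment_assumption f\<^sub>0 f\<^sub>1 \<Phi>"
  shows "pos_def_mat (F_mat f\<^sub>0 f\<^sub>1 \<Phi>)"
  unfolding F_mat_def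
proof (rule pos_def_mat_add_semidef)
  show "transpose_mat (Cov_mat f\<^sub>1 \<Phi>) = Cov_mat f\<^sub>1 \<Phi>"
    by (intro eq_matI) (auto simp: Cov_mat_def Cov_commute)
qed (use assms in \<open>auto simp: moment_assumption_def intro!: Cov_mat_semidef\<close>)

text \<open>Appending at the end of the list puts the new feature at the last index, so it only
  borders the old matrix. Symmetry of \<open>Cov\<close> lets the same vector serve as column and as
  row, and the corner is a variance because \<open>Var\<close> is \<open>Cov\<close> on the
  diagonal.\<close>

lemma F_mat_snoc:
  "F_mat f\<^sub>0 f\<^sub>1 (\<Phi> @ [\<psi>]) =
     four_block_mat (F_mat f\<^sub>0 f\<^sub>1 \<Phi>)
       (mat_of_cols (length \<Phi>) [Cov_vec f\<^sub>0 \<Phi> \<psi> + Cov_vec f\<^sub>1 \<Phi> \<psi>])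
       (mat_of_rows (length \<Phi>) [Cov_vec f\<^sub>0 \<Phi> \<psi> + Cov_vec f\<^sub>1 \<Phi> \<psi>])
       (mat 1 1 (\<lambda>_. Var f\<^sub>0 \<psi> + Var f\<^sub>1 \<psi>))"
  by (intro eq_matI)
    (auto simp: F_mat_def Cov_mat_def Cov_vec_def mat_of_cols_def mat_of_rows_def nth_append
      Var_eq_Cov Cov_commute less_Suc_eq)

lemma Y_vec_snoc:
  "Y_vec f\<^sub>0 f\<^sub>1 (\<Phi> @ [\<psi>]) = Y_vec f\<^sub>0 f\<^sub>1 \<Phi> @\<^sub>v vec 1 (\<lambda>_. expect f\<^sub>1 \<psi> - expect f\<^sub>0 \<psi>)"
  by (intro eq_vecI) (auto simp: Y_vec_def expect_vec_def nth_append less_Suc_eq)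

theorem proposition4p3:
  fixes f\<^sub>0 f\<^sub>1 \<psi> :: "real \<Rightarrow> real" and \<Phi> :: dictionary
    and s :: nat and A :: "real mat" and b y :: "real vec" and d \<eta> Yt S :: real
  assumes "prob_density_fun f\<^sub>0" and "prob_density_fun f\<^sub>1"
    and "length \<Phi> = s"
    and "moment_assumption f\<^sub>0 f\<^sub>1 \<Phi>"
    and "moment_assumption f\<^sub>0 f\<^sub>1 (\<Phi> @ [\<psi>])"
    and "A = F_mat f\<^sub>0 f\<^sub>1 \<Phi>"
    and "y = Y_vec f\<^sub>0 f\<^sub>1 \<Phi>"
    and "b = Cov_vec f\<^sub>0 \<Phi> \<psi> + Cov_vec f\<^sub>1 \<Phi> \<psi>"
    and "d = Var f\<^sub>0 \<psi> + Var f\<^sub>1 \<psi>"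
    and "\<eta> = expect f\<^sub>1 \<psi> - expect f\<^sub>0 \<psi>"
    and "Yt = \<eta> - b \<bullet> (inv_mat A *\<^sub>v y)"
    and "S = d - b \<bullet> (inv_mat A *\<^sub>v b)"
  shows "F_mat f\<^sub>0 f\<^sub>1 (\<Phi> @ [\<psi>]) =
           four_block_mat A (mat_of_cols s [b]) (mat_of_rows s [b]) (mat 1 1 (\<lambda>_. d)) \<and>
         Y_vec f\<^sub>0 f\<^sub>1 (\<Phi> @ [\<psi>]) = y @\<^sub>v vec 1 (\<lambda>_. \<eta>) \<and>
         S > 0 \<and>
         J_val f\<^sub>0 f\<^sub>1 (\<Phi> @ [\<psi>]) - J_val f\<^sub>0 f\<^sub>1 \<Phi> = Yt\<^sup>2 / S \<and>
         Yt\<^sup>2 / S \<ge> 0 \<and>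
         (J_val f\<^sub>0 f\<^sub>1 (\<Phi> @ [\<psi>]) - J_val f\<^sub>0 f\<^sub>1 \<Phi> = 0 \<longleftrightarrow> Yt = 0)"
proof -
  have A: "A \<in> carrier_mat s s" and y: "y \<in> carrier_vec s" and b: "b \<in> carrier_vec s"
    using assms(3,6-8) by (auto simp: Cov_vec_def)
  have Apd: "pos_def_mat A" and Mpd: "pos_def_mat (F_mat f\<^sub>0 f\<^sub>1 (\<Phi> @ [\<psi>]))"
    using F_mat_pos_def assms(2,4-6) by auto
  have F: "F_mat f\<^sub>0 f\<^sub>1 (\<Phi> @ [\<psi>]) =
      four_block_mat A (mat_of_cols s [b]) (mat_of_rows s [b]) (mat 1 1 (\<lambda>_. d))"
    using F_mat_snoc[of f\<^sub>0 f\<^sub>1 \<Phi> \<psi>] by (simp only: assms(3,6,8,9))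
  have Y: "Y_vec f\<^sub>0 f\<^sub>1 (\<Phi> @ [\<psi>]) = y @\<^sub>v vec 1 (\<lambda>_. \<eta>)"
    using Y_vec_snoc[of f\<^sub>0 f\<^sub>1 \<Phi> \<psi>] by (simp only: assms(7,10))
  note schur = schur_complement_pos_def[OF A b y Apd F Mpd assms(12,11)]
  have "J_val f\<^sub>0 f\<^sub>1 (\<Phi> @ [\<psi>]) - J_val f\<^sub>0 f\<^sub>1 \<Phi> = Yt\<^sup>2 / S"
    using schur(2) by (simp add: J_val_def Y assms(6,7))
  \<comment> \<open>Since \<open>S > 0\<close>, the quotient \<open>Yt\<^sup>2 / S\<close> is
    nonnegative and vanishes exactly when \<open>Yt\<close> does.\<close>
  then show ?thesis
    using F Y schur(1) by simp
qed

end
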